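(* Let $\alpha>0$, $\kappa\in(0,2]$, $c_Y>0$, let $Y\in\mathbf{S}(\alpha,\kappa,c_Y)$ and let $R>0$. Then \[ \mathcal{H}_Y^R\;\ge\;\frac12\left(1+\sqrt{1+\frac1R}\right). \]
   Context: Class $\mathbf{S}(\alpha,\kappa,c_Y)$ (with $\alpha>0$, $\kappa\in(0,2]$, $c_Y>0$): a centered Gaussian process $Y=\{Y(t):t\ge 0\}$ with a.s. continuous sample paths belongs to $\mathbf{S}(\alpha,\kappa,c_Y)$ if (S1) $Y$ is self-similar with index $\alpha/2$, i.e. for every $a>0$ the processes $\{Y(at):t\ge0\}$ and $\{a^{\alpha/2}Y(t):t\ge0\}$ have the same law, and $\mathbf{Var}(Y(1))=1$ (hence $\mathbf{Var}(Y(t))=t^\alpha$); (S2) $\mathbf{Var}(Y(1)-Y(1-h))=c_Y|h|^\kappa+o(|h|^\kappa)$ as $h\to0$. For such $Y$ and $R>0$, $\mathcal{H}_Y^R:=\lim_{T\to\infty}\mathbf{E}\exp\left(\sup_{t\in[0,T]}\left(\sqrt2\,Y(t)-(1+R)t^\alpha\right)\right)$ (the expectation is nondecreasing in $T$, so the limit exists). *)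

theory Defs
  imports "HOL-Probability.Probability" "HOL-Library.Landau_Symbols"
begin

definition gaussian_rv :: "'a measure \<Rightarrow> ('a \<Rightarrow> real) \<Rightarrow> bool" where
  \<comment> \<open>Degenerate (a.s. constant) variables count as Gaussian; this is needed for the
      finite-dimensional laws of a process such as one with Y(0) = 0.\<close>
  "gaussian_rv M X \<longleftrightarrow> X \<in> borel_measurable M \<and>
     (\<exists>\<mu>. (AE \<omega> in M. X \<omega> = \<mu>) \<or>
          (\<exists>\<sigma>>0. distributed M lborel X (normal_density \<mu> \<sigma>)))"

text \<open>Processes are indexed by the half-line \<open>t \<ge> 0\<close>; the values \<open>Y t\<close> for negative \<open>t\<close>
  are never constrained or used.\<close>

definition gaussian_process :: "'a measure \<Rightarrow> (real \<Rightarrow> 'a \<Rightarrow> real) \<Rightarrow> bool" where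
  "gaussian_process M Y \<longleftrightarrow>
     (\<forall>J c. finite J \<and> J \<subseteq> {0..} \<longrightarrow> gaussian_rv M (\<lambda>\<omega>. \<Sum>t\<in>J. c t * Y t \<omega>))"

definition process_law :: "'a measure \<Rightarrow> (real \<Rightarrow> 'a \<Rightarrow> real) \<Rightarrow> (real \<Rightarrow> real) measure" where
  \<comment> \<open>law on the space of all functions on the half-line with the product sigma-algebra;
      equality of laws amounts to equality of all finite-dimensional distributions\<close>
  "process_law M Y =
     distr M (\<Pi>\<^sub>M t\<in>{0..}. (borel :: real measure)) (\<lambda>\<omega>. \<lambda>t\<in>{0..}. Y t \<omega>)"

definition self_similar :: "'a measure \<Rightarrow> (real \<Rightarrow> 'a \<Rightarrow> real) \<Rightarrow> real \<Rightarrow> bool" where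
  "self_similar M Y H \<longleftrightarrow>
     (\<forall>a>0. process_law M (\<lambda>t. Y (a * t)) = process_law M (\<lambda>t \<omega>. a powr H * Y t \<omega>))"

locale class_S = prob_space M
  for M :: "'a measure" and Y :: "real \<Rightarrow> 'a \<Rightarrow> real" and \<alpha> \<kappa> c\<^sub>Y :: real +
  assumes gaussian: "gaussian_process M Y"
    and centered: "\<And>t. t \<ge> 0 \<Longrightarrow> expectation (Y t) = 0"
    and continuous_paths: "AE \<omega> in M. continuous_on {0..} (\<lambda>t. Y t \<omega>)"
    and S1_self_similar: "self_similar M Y (\<alpha> / 2)"
    and S1_variance: "variance (Y 1) = 1"
    and S2: "(\<lambda>h. variance (\<lambda>\<omega>. Y 1 \<omega> - Y (1 - h) \<omega>) - c\<^sub>Y * \<bar>h\<bar> powr \<kappa>)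
               \<in> o[at 0](\<lambda>h. \<bar>h\<bar> powr \<kappa>)"

text \<open>The expectation is taken in \<open>[0,\<infinity>]\<close>, so no integrability is presupposed.  The
  real-valued supremum is meaningful on the a.s. event of continuous paths; the Lebesgue
  integral does not depend on the values off that event.\<close>

definition sup_expectation ::
  "'a measure \<Rightarrow> (real \<Rightarrow> 'a \<Rightarrow> real) \<Rightarrow> real \<Rightarrow> real \<Rightarrow> real \<Rightarrow> ennreal" where
  "sup_expectation M Y \<alpha> R T =
     (\<integral>\<^sup>+\<omega>. ennreal (exp (SUP t\<in>{0..T}. sqrt 2 * Y t \<omega> - (1 + R) * t powr \<alpha>)) \<partial>M)"

definition generalized_pickands ::
  "'a measure \<Rightarrow> (real \<Rightarrow> 'a \<Rightarrow> real) \<Rightarrow> real \<Rightarrow> real \<Rightarrow> ennreal" where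
  "generalized_pickands M Y \<alpha> R = Lim at_top (sup_expectation M Y \<alpha> R)"

lemma sup_expectation_mono:
  assumes paths: "AE \<omega> in M. continuous_on {0..} (\<lambda>t. Y t \<omega>)"
    and "\<alpha> > 0" "0 \<le> S" "S \<le> T"
  shows "sup_expectation M Y \<alpha> R S \<le> sup_expectation M Y \<alpha> R T"
  unfolding sup_expectation_def
proof (rule nn_integral_mono_AE, use paths in eventually_elim)
  case (elim \<omega>)
  let ?f = "\<lambda>t. sqrt 2 * Y t \<omega> - (1 + R) * t powr \<alpha>"
  have "continuous_on {0..T} (\<lambda>t. Y t \<omega>)"
    using elim by (rule continuous_on_subset) auto
  then have "continuous_on {0..T} ?f"
    using \<open>\<alpha> > 0\<close> by (intro continuous_intros continuous_on_powr') auto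
  then have "bdd_above (?f ` {0..T})"
    by (intro bounded_imp_bdd_above compact_imp_bounded compact_continuous_image) auto
  then have "(SUP t\<in>{0..S}. ?f t) \<le> (SUP t\<in>{0..T}. ?f t)"
    using assms by (intro cSUP_subset_mono) auto
  then show ?case by (simp add: ennreal_leI)
qed

lemma (in class_S) tendsto_generalized_pickands:
  assumes "\<alpha> > 0"
  shows "(sup_expectation M Y \<alpha> R \<longlongrightarrow> generalized_pickands M Y \<alpha> R) at_top"
proof -
  let ?F = "sup_expectation M Y \<alpha> R"
  have "(?F \<longlongrightarrow> (SUP T\<in>{0..}. ?F T)) at_top"
  proof (rule increasing_tendsto)
    show "\<forall>\<^sub>F T in at_top. ?F T \<le> (SUP T\<in>{0..}. ?F T)"
      using eventually_ge_at_top[of 0] by eventually_elim (auto intro: SUP_upper)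
    fix x assume "x < (SUP T\<in>{0..}. ?F T)"
    then obtain S where S: "S \<ge> 0" "x < ?F S" by (auto simp: less_SUP_iff)
    show "\<forall>\<^sub>F T in at_top. x < ?F T"
      using eventually_ge_at_top[of S]
      by eventually_elim
        (use S sup_expectation_mono[OF continuous_paths assms] in \<open>blast intro: less_le_trans\<close>)
  qed
  then show ?thesis
    unfolding generalized_pickands_def by (metis tendsto_Lim trivial_limit_at_top_linorder)
qed

end

theory Submission
  imports Defs
begin

text \<open>No Gaussian comparison inequality is needed.  Bounding \<open>P (sup \<ge> u)\<close> below by the
  probability at the best single time \<open>t\<close> already gives the tail of the degenerate process
  \<open>t powr (\<alpha> / 2) * \<xi>\<close> with \<open>\<xi>\<close> standard normal, whose supremum is
  \<open>(max 0 \<xi>)\<^sup>2 / (2 * (1 + R))\<close>.  The exponential moment of the latter is the claimed bound.\<close>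

section \<open>Integrals through tails\<close>

text \<open>Layer-cake formula: both sides measure the region under the graph of \<open>f\<close>,
  sliced along \<open>\<omega>\<close> or along \<open>v\<close>, so Fubini applies. Since
  \<open>v\<close> is real, the value \<open>top\<close> corresponds to the slice
  \<open>{0..}\<close> of infinite length.\<close>

lemma (in sigma_finite_measure) nn_integral_eq_tail_integral:
  fixes f :: "'a \<Rightarrow> ennreal"
  assumes [measurable]: "f \<in> borel_measurable M"
  shows "(\<integral>\<^sup>+\<omega>. f \<omega> \<partial>M) =
    (\<integral>\<^sup>+v. indicator {0..} v * emeasure M {\<omega> \<in> space M. ennreal v \<le> f \<omega>} \<partial>lborel)"
proof -
  interpret pair_sigma_finite M lborel
    by (simp add: pair_sigma_finite_def sigma_finite_measure_axioms lborel.sigma_finite_measure_axioms)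
  let ?I = "\<lambda>\<omega> v. indicator {0..} v * indicator {v. ennreal v \<le> f \<omega>} v :: ennreal"
  have inner: "(\<integral>\<^sup>+v. ?I \<omega> v \<partial>lborel) = f \<omega>" for \<omega>
  proof -
    have "(\<integral>\<^sup>+v. ?I \<omega> v \<partial>lborel) = (\<integral>\<^sup>+v. indicator {v. 0 \<le> v \<and> ennreal v \<le> f \<omega>} v \<partial>lborel)"
      by (intro nn_integral_cong) (auto split: split_indicator)
    also have "\<dots> = emeasure lborel {v. 0 \<le> v \<and> ennreal v \<le> f \<omega>}"
      by simp
    also have "\<dots> = f \<omega>"
    proof (cases "f \<omega>")
      case (real r)
      then have "{v. 0 \<le> v \<and> ennreal v \<le> f \<omega>} = {0..r}" by auto
      with real show ?thesis by simp
    next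
      case top
      then have "{v. 0 \<le> v \<and> ennreal v \<le> f \<omega>} = {0::real..}" by auto
      moreover have "emeasure lborel {0::real..} = \<top>"
      proof -
        have "(SUP n. of_nat n) \<le> emeasure lborel {0::real..}"
        proof (rule SUP_least)
          fix n :: nat
          have "emeasure lborel {0..real n} \<le> emeasure lborel {0::real..}"
            by (rule emeasure_mono) auto
          then show "of_nat n \<le> emeasure lborel {0::real..}"
            by (simp add: ennreal_of_nat_eq_real_of_nat)
        qed
        then show ?thesis
          by (simp add: ennreal_SUP_of_nat_eq_top top_unique)
      qed
      ultimately show ?thesis using top by simp
    qed
    finally show ?thesis .
  qed
  have "(\<integral>\<^sup>+\<omega>. f \<omega> \<partial>M) = (\<integral>\<^sup>+\<omega>. \<integral>\<^sup>+v. ?I \<omega> v \<partial>lborel \<partial>M)"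
    by (simp only: inner)
  also have "\<dots> = (\<integral>\<^sup>+v. \<integral>\<^sup>+\<omega>. ?I \<omega> v \<partial>M \<partial>lborel)"
    by (rule Fubini'[symmetric]) simp
  also have "\<dots> = (\<integral>\<^sup>+v. indicator {0..} v * emeasure M {\<omega> \<in> space M. ennreal v \<le> f \<omega>} \<partial>lborel)"
  proof (intro nn_integral_cong)
    fix v :: real
    have "(\<integral>\<^sup>+\<omega>. ?I \<omega> v \<partial>M) = indicator {0..} v * (\<integral>\<^sup>+\<omega>. indicator {v. ennreal v \<le> f \<omega>} v \<partial>M)"
      by (subst nn_integral_cmult) auto
    also have "(\<integral>\<^sup>+\<omega>. indicator {v. ennreal v \<le> f \<omega>} v \<partial>M) =
        (\<integral>\<^sup>+\<omega>. indicator {\<omega> \<in> space M. ennreal v \<le> f \<omega>} \<omega> \<partial>M)"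
      by (intro nn_integral_cong) (auto split: split_indicator)
    also have "\<dots> = emeasure M {\<omega> \<in> space M. ennreal v \<le> f \<omega>}"
      by simp
    finally show "(\<integral>\<^sup>+\<omega>. ?I \<omega> v \<partial>M) = indicator {0..} v * emeasure M {\<omega> \<in> space M. ennreal v \<le> f \<omega>}" .
  qed
  finally show ?thesis .
qed

text \<open>Stochastic domination suffices to compare integrals. A pointwise comparison would not be
  available later, because the time used to bound the tail changes with the level
  \<open>v\<close>.\<close>

lemma (in sigma_finite_measure) nn_integral_mono_tail:
  fixes f g :: "'a \<Rightarrow> ennreal"
  assumes "f \<in> borel_measurable M" "g \<in> borel_measurable M"
    and "\<And>v. v \<ge> 0 \<Longrightarrow> emeasure M {\<omega> \<in> space M. ennreal v \<le> f \<omega>} \<le> emeasure M {\<omega> \<in> space M. ennreal v \<le> g \<omega>}"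
  shows "(\<integral>\<^sup>+\<omega>. f \<omega> \<partial>M) \<le> (\<integral>\<^sup>+\<omega>. g \<omega> \<partial>M)"
  unfolding nn_integral_eq_tail_integral[OF assms(1)] nn_integral_eq_tail_integral[OF assms(2)]
  by (intro nn_integral_mono) (use assms(3) in \<open>auto split: split_indicator\<close>)

section \<open>An exponential moment of the normal distribution\<close>

lemma nn_integral_normal_density:
  "\<sigma> > 0 \<Longrightarrow> (\<integral>\<^sup>+x. ennreal (normal_density \<mu> \<sigma> x) \<partial>lborel) = 1"
  by (simp add: nn_integral_eq_integral)

text \<open>Adding the integrand at x and -x removes the positive part: one exponential is 1, the
  other carries the full square. Hence twice the integral is 1 plus the moment without positive
  part, and the latter is the total mass of a rescaled normal density.\<close>

lemma nn_integral_exp_positive_part: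
  fixes R :: real
  assumes "R > 0"
  shows "(\<integral>\<^sup>+x. ennreal (std_normal_density x) * ennreal (exp ((max 0 x)\<^sup>2 / (2 * (1 + R)))) \<partial>lborel)
    = ennreal (1 / 2 * (1 + sqrt (1 + 1 / R)))" (is "?I = _")
proof -
  \<comment> \<open>Chosen so that \<open>1 / \<sigma>\<^sup>2 = 1 - 1 / (1 + R)\<close>: the weight
    turns the standard normal density into \<sigma> times the centered normal density with standard
    deviation \<sigma>.\<close>
  define \<sigma> where "\<sigma> = sqrt (1 + 1 / R)"
  have \<sigma>: "\<sigma> > 0" "\<sigma>\<^sup>2 = 1 + 1 / R"
    using assms by (auto simp: \<sigma>_def add_pos_pos)
  define h where "h x = ennreal (std_normal_density x) * ennreal (exp ((max 0 x)\<^sup>2 / (2 * (1 + R))))" for x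
  have [measurable]: "h \<in> borel_measurable borel"
    unfolding h_def by measurable
  have tilt: "std_normal_density x * exp (x\<^sup>2 / (2 * (1 + R))) = \<sigma> * normal_density 0 \<sigma> x" for x
  proof -
    have eq: "- x\<^sup>2 / 2 + x\<^sup>2 / (2 * (1 + R)) = - x\<^sup>2 / (2 * \<sigma>\<^sup>2)"
      using assms by (simp add: \<sigma>(2) divide_simps) (simp add: algebra_simps)
    have "std_normal_density x * exp (x\<^sup>2 / (2 * (1 + R))) = 1 / sqrt (2 * pi) * exp (- x\<^sup>2 / (2 * \<sigma>\<^sup>2))"
      unfolding std_normal_density_def eq[symmetric] exp_add by simp
    also have "\<dots> = \<sigma> * normal_density 0 \<sigma> x"
      using \<sigma>(1) by (simp add: normal_density_def real_sqrt_mult)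
    finally show ?thesis .
  qed
  have sym: "h x + h (- x) = ennreal (std_normal_density x) + ennreal \<sigma> * ennreal (normal_density 0 \<sigma> x)" for x
  proof -
    have "h x + h (- x) = ennreal (std_normal_density x) + ennreal (std_normal_density x * exp (x\<^sup>2 / (2 * (1 + R))))"
      by (cases "x \<ge> 0")
        (auto simp: h_def ennreal_mult'[symmetric] max_def std_normal_density_def add.commute)
    then show ?thesis
      unfolding tilt using \<sigma> by (simp add: ennreal_mult)
  qed
  have refl: "(\<integral>\<^sup>+x. h (- x) \<partial>lborel) = (\<integral>\<^sup>+x. h x \<partial>lborel)"
    using nn_integral_real_affine[of h "- 1" 0] by simp
  have "(\<integral>\<^sup>+x. h x \<partial>lborel) + (\<integral>\<^sup>+x. h x \<partial>lborel) = (\<integral>\<^sup>+x. h x + h (- x) \<partial>lborel)"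
    by (subst nn_integral_add) (simp_all add: refl)
  also have "\<dots> = 1 + ennreal \<sigma>"
    unfolding sym using \<sigma>(1)
    by (subst nn_integral_add) (simp_all add: nn_integral_cmult nn_integral_normal_density)
  finally have dbl: "?I + ?I = ennreal (1 + \<sigma>)"
    using \<sigma>(1) by (simp add: h_def ennreal_plus)
  show ?thesis
  \<comment> \<open>Halving \<open>dbl\<close> takes place in the reals, so an infinite integral is
    excluded separately.\<close>
  proof (cases ?I)
    case (real r)
    with dbl have "ennreal (r + r) = ennreal (1 + \<sigma>)"
      by (simp only: ennreal_plus)
    then have "r + r = 1 + \<sigma>"
      using real \<sigma>(1) by (subst (asm) ennreal_inj) auto
    then have "r = 1 / 2 * (1 + \<sigma>)" by simp
    with real show ?thesis by (simp add: \<sigma>_def)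
  next
    case top
    with dbl show ?thesis by simp
  qed
qed

section \<open>One-dimensional marginals of \<open>Y\<close>\<close>

context class_S
begin

lemma measurable_Y [measurable]: "t \<ge> 0 \<Longrightarrow> Y t \<in> borel_measurable M"
  using gaussian[unfolded gaussian_process_def, rule_format, of "{t}" "\<lambda>_. 1"]
  by (simp add: gaussian_rv_def)

text \<open>\<open>gaussian_rv\<close> admits constants, and in either alternative the vanishing
  expectation forces \<mu> to be 0.\<close>

lemma Y_cases:
  assumes "t \<ge> 0"
  obtains "AE \<omega> in M. Y t \<omega> = 0"
  | \<sigma> where "\<sigma> > 0" "distributed M lborel (Y t) (normal_density 0 \<sigma>)"
proof -
  note [measurable] = measurable_Y[OF assms]
  have "gaussian_rv M (Y t)"
    using gaussian[unfolded gaussian_process_def, rule_format, of "{t}" "\<lambda>_. 1"] assms by simp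
  then obtain \<mu> where "(AE \<omega> in M. Y t \<omega> = \<mu>) \<or>
      (\<exists>\<sigma>>0. distributed M lborel (Y t) (normal_density \<mu> \<sigma>))"
    by (auto simp: gaussian_rv_def)
  then consider "AE \<omega> in M. Y t \<omega> = \<mu>"
    | \<sigma> where "\<sigma> > 0" "distributed M lborel (Y t) (normal_density \<mu> \<sigma>)" by blast
  then show thesis
  proof cases
    case 1
    then have "expectation (Y t) = expectation (\<lambda>_. \<mu>)"
      by (intro integral_cong_AE) auto
    with centered[OF assms] have "\<mu> = 0" by (simp add: prob_space)
    with 1 that(1) show thesis by simp
  next
    case 2
    then have "\<mu> = 0"
      using centered[OF assms] normal_distributed_expectation[OF 2] by simp
    with 2 that(2) show thesis by simp
  qed
qed

text \<open>The unit variance both rules out the degenerate alternative and fixes \<sigma> =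
  1.\<close>

lemma Y1_std_normal: "distributed M lborel (Y 1) std_normal_density"
proof (rule Y_cases[of 1])
  assume "AE \<omega> in M. Y 1 \<omega> = 0"
  then have "expectation (\<lambda>\<omega>. (Y 1 \<omega>)\<^sup>2) = expectation (\<lambda>_. 0)"
    by (intro integral_cong_AE) auto
  with S1_variance show ?thesis by (simp add: centered)
next
  fix \<sigma> :: real assume \<sigma>: "\<sigma> > 0" "distributed M lborel (Y 1) (normal_density 0 \<sigma>)"
  then have "\<sigma>\<^sup>2 = 1" using normal_distributed_variance[OF \<sigma>] S1_variance by simp
  with \<sigma> show ?thesis by (simp add: power2_eq_1_iff)
qed simp

text \<open>The coordinate projection at \<open>t\<close> pushes the equality of process laws
  forward to this marginal.\<close>

lemma distr_Y_scale:
  assumes "a > 0" "t \<ge> 0"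
  shows "distr M borel (Y (a * t)) = distr M borel (\<lambda>\<omega>. a powr (\<alpha> / 2) * Y t \<omega>)"
proof -
  let ?P = "\<Pi>\<^sub>M t\<in>{0::real..}. (borel :: real measure)"
  have marginal: "distr (process_law M Z) borel (\<lambda>x. x t) = distr M borel (Z t)"
    if [measurable]: "\<And>t. t \<ge> 0 \<Longrightarrow> Z t \<in> borel_measurable M" for Z
  proof -
    have "(\<lambda>\<omega>. \<lambda>t\<in>{0..}. Z t \<omega>) \<in> measurable M ?P"
      by (rule measurable_restrict) auto
    moreover have "(\<lambda>x. x t) \<in> measurable ?P borel"
      using assms by (intro measurable_component_singleton) auto
    ultimately show ?thesis
      unfolding process_law_def using assms by (subst distr_distr) (auto simp: comp_def)
  qed
  have "process_law M (\<lambda>t. Y (a * t)) = process_law M (\<lambda>t \<omega>. a powr (\<alpha> / 2) * Y t \<omega>)"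
    using S1_self_similar \<open>a > 0\<close> by (auto simp: self_similar_def)
  moreover have "distr (process_law M (\<lambda>t. Y (a * t))) borel (\<lambda>x. x t) = distr M borel (Y (a * t))"
    by (rule marginal) (use assms in auto)
  moreover have "distr (process_law M (\<lambda>t \<omega>. a powr (\<alpha> / 2) * Y t \<omega>)) borel (\<lambda>x. x t)
      = distr M borel (\<lambda>\<omega>. a powr (\<alpha> / 2) * Y t \<omega>)"
    by (rule marginal) auto
  ultimately show ?thesis by metis
qed

text \<open>Time 0 is fixed by scaling, so \<open>Y 0\<close> and its multiples by
  \<open>a powr (\<alpha> / 2)\<close> have the same law; a positive variance cannot survive
  this.\<close>

lemma Y0_eq_0:
  assumes "\<alpha> > 0"
  shows "AE \<omega> in M. Y 0 \<omega> = 0"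
proof (rule Y_cases[of 0])
  fix \<sigma> :: real assume \<sigma>: "\<sigma> > 0" "distributed M lborel (Y 0) (normal_density 0 \<sigma>)"
  \<comment> \<open>Makes the space factor equal to 2, so that \<sigma> would satisfy
    \<open>\<sigma>\<^sup>2 = 4 * \<sigma>\<^sup>2\<close>.\<close>
  define a :: real where "a = 2 powr (2 / \<alpha>)"
  have a: "a > 0" "a powr (\<alpha> / 2) = 2"
    using assms by (auto simp: a_def powr_powr)
  have "expectation (\<lambda>\<omega>. (Y 0 \<omega>)\<^sup>2) = (\<integral>x. x\<^sup>2 \<partial>distr M borel (Y 0))"
    by (subst integral_distr) auto
  also have "\<dots> = expectation (\<lambda>\<omega>. (2 * Y 0 \<omega>)\<^sup>2)"
    using distr_Y_scale[OF a(1), of 0] a(2) by (simp, subst integral_distr) auto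
  finally have "expectation (\<lambda>\<omega>. (Y 0 \<omega>)\<^sup>2) = 4 * expectation (\<lambda>\<omega>. (Y 0 \<omega>)\<^sup>2)"
    by (simp add: power_mult_distrib)
  moreover have "expectation (\<lambda>\<omega>. (Y 0 \<omega>)\<^sup>2) = \<sigma>\<^sup>2"
    using normal_distributed_variance[OF \<sigma>] by (simp add: centered)
  ultimately show ?thesis using \<sigma>(1) by simp
qed auto

lemma emeasure_Y_ge:
  assumes "a > 0"
  shows "emeasure M {\<omega> \<in> space M. b \<le> Y a \<omega>} = emeasure M {\<omega> \<in> space M. b \<le> a powr (\<alpha> / 2) * Y 1 \<omega>}"
proof -
  have "emeasure (distr M borel (Y a)) {b..} = emeasure (distr M borel (\<lambda>\<omega>. a powr (\<alpha> / 2) * Y 1 \<omega>)) {b..}"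
    using distr_Y_scale[OF assms, of 1] by simp
  then show ?thesis
    using assms by (simp add: emeasure_distr vimage_def Int_def conj_commute)
qed

end

section \<open>The supremum over rational times\<close>

text \<open>The supremum over the half-line need not be measurable, so it is replaced by the
  supremum over nonnegative rationals.\<close>

definition rational_sup :: "(real \<Rightarrow> 'a \<Rightarrow> real) \<Rightarrow> real \<Rightarrow> real \<Rightarrow> 'a \<Rightarrow> ennreal" where
  "rational_sup Y \<alpha> R \<omega> =
     (SUP t\<in>\<rat> \<inter> {0..}. ennreal (exp (sqrt 2 * Y t \<omega> - (1 + R) * t powr \<alpha>)))"

context class_S
begin

lemma measurable_rational_sup [measurable]: "rational_sup Y \<alpha> R \<in> borel_measurable M"
  unfolding rational_sup_def[abs_def]
  by (intro borel_measurable_SUP) (auto intro: countable_Int1 countable_rat)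

text \<open>Along a continuous path the times at which the bound holds form a closed set; it
  contains the nonnegative rationals, which are dense in the half-line.\<close>

lemma rational_sup_upper:
  assumes "\<alpha> > 0" "t \<ge> 0" "continuous_on {0..} (\<lambda>t. Y t \<omega>)"
  shows "ennreal (exp (sqrt 2 * Y t \<omega> - (1 + R) * t powr \<alpha>)) \<le> rational_sup Y \<alpha> R \<omega>"
proof -
  let ?f = "\<lambda>t. ennreal (exp (sqrt 2 * Y t \<omega> - (1 + R) * t powr \<alpha>))"
  have "continuous_on {0..} ?f"
    using assms by (intro continuous_on_ennreal continuous_intros continuous_on_powr') auto
  then have "closed ({0..} \<inter> ?f -` {..rational_sup Y \<alpha> R \<omega>})"
    by (intro continuous_closed_preimage) auto
  moreover have "\<rat> \<inter> {0..} \<subseteq> {0..} \<inter> ?f -` {..rational_sup Y \<alpha> R \<omega>}"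
    unfolding rational_sup_def by (auto intro: SUP_upper)
  ultimately have "closure (\<rat> \<inter> {0..}) \<subseteq> {0..} \<inter> ?f -` {..rational_sup Y \<alpha> R \<omega>}"
    by (rule closure_minimal[rotated])
  moreover have "closure (\<rat> \<inter> {0..}) = {0::real..}"
    using closure_convex_Int_superset[of "{0::real..}" \<rat>]
    by (simp add: interior_real_atLeast Rats_closure_real Int_commute)
  ultimately show ?thesis using \<open>t \<ge> 0\<close> by auto
qed

text \<open>Monotone convergence along the horizons \<open>n\<close>: a supremum over rational times
  up to \<open>n\<close> is almost surely below the one over the whole interval, whose expectation
  is below its limit.\<close>

lemma nn_integral_rational_sup_le:
  assumes "\<alpha> > 0"
  shows "(\<integral>\<^sup>+\<omega>. rational_sup Y \<alpha> R \<omega> \<partial>M) \<le> generalized_pickands M Y \<alpha> R"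
proof -
  let ?f = "\<lambda>t \<omega>. sqrt 2 * Y t \<omega> - (1 + R) * t powr \<alpha>"
  define G where "G n \<omega> = (SUP t\<in>\<rat> \<inter> {0..real n}. ennreal (exp (?f t \<omega>)))" for n \<omega>
  have G_measurable [measurable]: "G n \<in> borel_measurable M" for n
    unfolding G_def[abs_def] by (intro borel_measurable_SUP) (auto intro: countable_Int1 countable_rat)
  have "incseq G"
    unfolding G_def by (auto simp: incseq_def le_fun_def intro!: SUP_subset_mono)
  have "\<rat> \<inter> {0..} = (\<Union>n. \<rat> \<inter> {0..real n})"
    using real_arch_simple by fastforce
  then have "rational_sup Y \<alpha> R \<omega> = (SUP n. G n \<omega>)" for \<omega>
    unfolding rational_sup_def G_def by (simp only: SUP_UNION)
  then have "(\<integral>\<^sup>+\<omega>. rational_sup Y \<alpha> R \<omega> \<partial>M) = (SUP n. \<integral>\<^sup>+\<omega>. G n \<omega> \<partial>M)"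
    using \<open>incseq G\<close> by (simp add: nn_integral_monotone_convergence_SUP)
  also have "\<dots> \<le> generalized_pickands M Y \<alpha> R"
  proof (rule SUP_least)
    fix n
    have "(\<integral>\<^sup>+\<omega>. G n \<omega> \<partial>M) \<le> sup_expectation M Y \<alpha> R (real n)"
      unfolding sup_expectation_def
    proof (rule nn_integral_mono_AE, use continuous_paths in eventually_elim)
      case (elim \<omega>)
      have "continuous_on {0..real n} (\<lambda>t. Y t \<omega>)"
        using elim by (rule continuous_on_subset) auto
      then have "continuous_on {0..real n} (\<lambda>t. ?f t \<omega>)"
        using \<open>\<alpha> > 0\<close> by (intro continuous_intros continuous_on_powr') auto
      then have "bdd_above ((\<lambda>t. ?f t \<omega>) ` {0..real n})"
        by (intro bounded_imp_bdd_above compact_imp_bounded compact_continuous_image) auto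
      then show ?case
        unfolding G_def by (auto intro!: SUP_least ennreal_leI cSUP_upper)
    qed
    also have "\<dots> \<le> generalized_pickands M Y \<alpha> R"
    \<comment> \<open>Monotonicity in the horizon puts each finite-horizon value below the
      limit.\<close>
    proof (rule tendsto_lowerbound[OF tendsto_generalized_pickands[OF assms]])
      show "\<forall>\<^sub>F T in at_top. sup_expectation M Y \<alpha> R (real n) \<le> sup_expectation M Y \<alpha> R T"
        using eventually_ge_at_top[of "real n"]
        by eventually_elim (auto intro!: sup_expectation_mono continuous_paths assms)
    qed simp
    finally show "(\<integral>\<^sup>+\<omega>. G n \<omega> \<partial>M) \<le> generalized_pickands M Y \<alpha> R" .
  qed
  finally show ?thesis .
qed

section \<open>Comparison of tails\<close>

text \<open>For \<open>v = exp u\<close> with \<open>u > 0\<close>, the time \<open>t\<close> with \<open>t powr \<alpha> = u / (1 + R)\<close> maximises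
  \<open>P (sqrt 2 * Y t - (1 + R) * t powr \<alpha> \<ge> u)\<close>, and there this probability is exactly
  \<open>P (Y 1 \<ge> sqrt (2 * (1 + R) * u))\<close>.\<close>

lemma tail_rational_sup_ge:
  assumes "\<alpha> > 0" "R > 0"
  shows "emeasure M {\<omega> \<in> space M. ennreal v \<le> ennreal (exp ((max 0 (Y 1 \<omega>))\<^sup>2 / (2 * (1 + R))))}
     \<le> emeasure M {\<omega> \<in> space M. ennreal v \<le> rational_sup Y \<alpha> R \<omega>}"
proof (cases "v \<le> 1")
  case True
  \<comment> \<open>At these levels the right-hand event is almost sure: time 0 alone contributes
    \<open>exp 0\<close>, as \<open>Y 0\<close> vanishes almost surely.\<close>
  have "AE \<omega> in M. ennreal v \<le> rational_sup Y \<alpha> R \<omega>"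
    using Y0_eq_0[OF assms(1)] continuous_paths
  proof eventually_elim
    case (elim \<omega>)
    have "ennreal v \<le> 1"
      using True by (simp add: ennreal_le_1)
    also have "1 \<le> rational_sup Y \<alpha> R \<omega>"
      using rational_sup_upper[OF assms(1) order_refl elim(2), of R] elim(1) assms(1) by simp
    finally show ?case .
  qed
  then show ?thesis
    by (intro emeasure_mono_AE) auto
next
  case False
  define u where "u = ln v"
  define t where "t = (u / (1 + R)) powr (1 / \<alpha>)"
  have u: "u > 0" "v = exp u" using False by (auto simp: u_def)
  have t: "t > 0" "t powr \<alpha> = u / (1 + R)" "t powr (\<alpha> / 2) = sqrt (u / (1 + R))"
    using u assms by (auto simp: t_def powr_powr powr_half_sqrt)
  have [measurable]: "Y t \<in> borel_measurable M" using t by simp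
  \<comment> \<open>The drift at time \<open>t\<close> is exactly \<open>u\<close>, so reaching
    level \<open>u\<close> there requires \<open>sqrt 2 * Y t \<omega>\<close> to be at least
    \<open>2 * u\<close>; this explains the threshold \<open>sqrt 2 * u\<close>.\<close>
  have "{\<omega> \<in> space M. ennreal v \<le> ennreal (exp ((max 0 (Y 1 \<omega>))\<^sup>2 / (2 * (1 + R))))}
      \<subseteq> {\<omega> \<in> space M. sqrt 2 * u \<le> t powr (\<alpha> / 2) * Y 1 \<omega>}"
  proof safe
    fix \<omega> assume "ennreal v \<le> ennreal (exp ((max 0 (Y 1 \<omega>))\<^sup>2 / (2 * (1 + R))))"
    then have *: "2 * (1 + R) * u \<le> (max 0 (Y 1 \<omega>))\<^sup>2"
      using assms by (simp add: u(2) field_simps)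
    \<comment> \<open>Strict positivity of the level forces the positive part to coincide with
      \<open>Y 1 \<omega>\<close>.\<close>
    moreover have "0 < 2 * (1 + R) * u" using u assms by simp
    ultimately have "max 0 (Y 1 \<omega>) \<noteq> 0" by auto
    then have "Y 1 \<omega> > 0" "2 * (1 + R) * u \<le> (Y 1 \<omega>)\<^sup>2" using * by (auto simp: max_def split: if_splits)
    then have "sqrt (2 * (1 + R) * u) \<le> Y 1 \<omega>"
      using real_le_lsqrt u assms by simp
    then have "sqrt (u / (1 + R)) * sqrt (2 * (1 + R) * u) \<le> t powr (\<alpha> / 2) * Y 1 \<omega>"
      unfolding t(3) using u assms by (intro mult_left_mono) auto
    moreover have "sqrt (u / (1 + R)) * sqrt (2 * (1 + R) * u) = sqrt (2 * u\<^sup>2)"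
      unfolding real_sqrt_mult[symmetric] power2_eq_square
      using assms by (simp add: divide_simps)
    ultimately show "sqrt 2 * u \<le> t powr (\<alpha> / 2) * Y 1 \<omega>"
      using u by (simp add: real_sqrt_mult)
  qed
  then have "emeasure M {\<omega> \<in> space M. ennreal v \<le> ennreal (exp ((max 0 (Y 1 \<omega>))\<^sup>2 / (2 * (1 + R))))}
      \<le> emeasure M {\<omega> \<in> space M. sqrt 2 * u \<le> t powr (\<alpha> / 2) * Y 1 \<omega>}"
    by (intro emeasure_mono) auto
  \<comment> \<open>The two events may differ; self-similarity equates only their
    probabilities.\<close>
  also have "\<dots> = emeasure M {\<omega> \<in> space M. sqrt 2 * u \<le> Y t \<omega>}"
    using emeasure_Y_ge[OF t(1)] by simp
  also have "\<dots> \<le> emeasure M {\<omega> \<in> space M. ennreal v \<le> rational_sup Y \<alpha> R \<omega>}"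
  proof (rule emeasure_mono_AE)
    show "AE \<omega> in M. \<omega> \<in> {\<omega> \<in> space M. sqrt 2 * u \<le> Y t \<omega>} \<longrightarrow>
        \<omega> \<in> {\<omega> \<in> space M. ennreal v \<le> rational_sup Y \<alpha> R \<omega>}"
      using continuous_paths
    proof eventually_elim
      case (elim \<omega>)
      show ?case
      proof safe
        assume "sqrt 2 * u \<le> Y t \<omega>"
        then have "sqrt 2 * (sqrt 2 * u) \<le> sqrt 2 * Y t \<omega>" by (intro mult_left_mono) auto
        then have "u \<le> sqrt 2 * Y t \<omega> - (1 + R) * t powr \<alpha>"
          using assms by (simp add: t(2) mult.assoc[symmetric])
        then have "ennreal v \<le> ennreal (exp (sqrt 2 * Y t \<omega> - (1 + R) * t powr \<alpha>))"
          by (auto simp: u(2) intro!: ennreal_leI)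
        also have "\<dots> \<le> rational_sup Y \<alpha> R \<omega>"
          using rational_sup_upper[OF assms(1) _ elim] t(1) by simp
        finally show "ennreal v \<le> rational_sup Y \<alpha> R \<omega>" .
      qed
    qed
  qed simp
  finally show ?thesis .
qed

end

section \<open>The lower bound for the generalized Pickands constant\<close>

theorem proposition3p2:
  fixes M :: "'a measure" and Y :: "real \<Rightarrow> 'a \<Rightarrow> real" and \<alpha> \<kappa> c\<^sub>Y R :: real
  assumes "\<alpha> > 0" and "0 < \<kappa>" and "\<kappa> \<le> 2" and "c\<^sub>Y > 0"
    and "class_S M Y \<alpha> \<kappa> c\<^sub>Y"
    and "R > 0"
  shows "generalized_pickands M Y \<alpha> R \<ge> ennreal (1 / 2 * (1 + sqrt (1 + 1 / R)))"
proof -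
  interpret class_S M Y \<alpha> \<kappa> c\<^sub>Y by fact
  let ?h = "\<lambda>x::real. ennreal (exp ((max 0 x)\<^sup>2 / (2 * (1 + R))))"
  have "ennreal (1 / 2 * (1 + sqrt (1 + 1 / R))) = (\<integral>\<^sup>+x. ennreal (std_normal_density x) * ?h x \<partial>lborel)"
    using nn_integral_exp_positive_part[OF \<open>R > 0\<close>] by simp
  also have "\<dots> = (\<integral>\<^sup>+\<omega>. ?h (Y 1 \<omega>) \<partial>M)"
    by (rule distributed_nn_integral[OF Y1_std_normal]) measurable
  also have "\<dots> \<le> (\<integral>\<^sup>+\<omega>. rational_sup Y \<alpha> R \<omega> \<partial>M)"
    using tail_rational_sup_ge[OF \<open>\<alpha> > 0\<close> \<open>R > 0\<close>] by (intro nn_integral_mono_tail) simp_all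
  also have "\<dots> \<le> generalized_pickands M Y \<alpha> R"
    by (rule nn_integral_rational_sup_le[OF \<open>\<alpha> > 0\<close>])
  finally show ?thesis .
qed

end
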